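(* In the stationary case $g^t\equiv g$, let $\{z^t\}$ be the sequence of SQG-estimates at a point $x\in X$ and let $\overline z^t=\sum_{j=0}^t\rho_jz^j\big/\sum_{j=0}^t\rho_j$ be the Cesàro estimates. Let the density $g\in G$ be globally Hölder continuous at $x$ with constants $H=H(x)$, $\nu=\nu(x)>0$, let the kernel $K$ be a bounded Borel density with $\int_X K(y)\,dy=1$, $\sup_{y\in X} K(y)\le\overline K$ and $A=\int_{\mathbb{R}^r}\|y\|^{\nu}K(y)\,dy<+\infty$, and let $\{\rho_t\}$, $\{\theta_t\}$ be nonnegative deterministic sequences of numbers, with $\rho_0>0$ and all $\theta_t>0$. Then for any $t$ $$|\overline z^{t}-g(x)|^2\le\Big(\tfrac12(z^0-g(x))^2+2\overline g(x)AH\sum_{i=0}^t\rho_i\theta_i^{\nu}+\overline g^{2}(x)\sum_{i=0}^t\rho_i^2+\overline K^{2}\sum_{i=0}^t\rho_i^2\theta_i^{-2r}\Big)\Big(\sum_{i=0}^t\rho_i\Big)^{-1}+\zeta_t,$$ where the stochastic term $\zeta_t$ has zero mean $\mathbf{E}\zeta_t=0$ and variance $$D\zeta_t\le\overline g^{3}\Big(\sum_{i=0}^t\rho_i\Big)^{-2}\Big(\overline g\sum_{i=0}^t\rho_i^2+\overline K\sum_{i=0}^t\rho_i^2\theta_i^{-r}\Big).$$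
   Context: Let $X\subseteq\mathbb{R}^r$. $G$ is the class of functions $g$ on $X$ with $0\le\underline g(x)\le g(x)\le\overline g(x)\le\overline g$ for all $x\in X$, where $\underline g(\cdot),\overline g(\cdot)$ are given functions and $\overline g$ is a finite constant. $g$ is a probability density on $X$; the observations $\overline x_0,\overline x_1,\dots$ are i.i.d. random vectors with density $g$ on a probability space $(\Omega,\Sigma,P)$. $K\ge0$ is a kernel. Global Hölder continuity at $x$: there are $H=H(x)$ and $\nu=\nu(x)>0$ such that $|g(x)-g(y)|\le H\|x-y\|^{\nu}$ for all $y\in X$. SQG-estimates at $x$: given $z^0\in[\underline g(x),\overline g(x)]$, adjustment coefficients $\rho_t$ and window parameters $\theta_t$, $$z^{t+1}=\min\{\overline g(x),\max\{\underline g(x),\,z^t-\rho_t\xi_t\}\},\qquad \xi_t=z^t-\frac1{\theta_t^r}K\Big(\frac{\overline x_t-x}{\theta_t}\Big),\quad t=0,1,\dots$$ $\mathbf{E}$ and $D$ denote expectation and variance.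
   Formalization: Added hypothesis: for each t and almost every y outside X with K((y-x)/θ_t)≠0, g(x) ≤ H‖x-y‖^ν (Hölder bound with g extended by 0). Vacuous for X=R^r or windows inside X; without it the claim fails, e.g. X=[0,1], g=K=1 on X, x=1, H=0. *)

theory Defs
  imports "HOL-Probability.Probability"
begin

definition density_on :: "'a::euclidean_space set \<Rightarrow> ('a \<Rightarrow> real) \<Rightarrow> bool" where
  "density_on X f \<longleftrightarrow>
     set_borel_measurable borel X f \<and> (\<forall>y\<in>X. 0 \<le> f y) \<and>
     set_integrable lborel X f \<and> (LINT y:X|lborel. f y) = 1"

definition class_G ::
  "'a::euclidean_space set \<Rightarrow> ('a \<Rightarrow> real) \<Rightarrow> ('a \<Rightarrow> real) \<Rightarrow> real \<Rightarrow> ('a \<Rightarrow> real) set" where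
  "class_G X gl gu gbar =
     {g. \<forall>x\<in>X. 0 \<le> gl x \<and> gl x \<le> g x \<and> g x \<le> gu x \<and> gu x \<le> gbar}"

definition globally_holder_at ::
  "'a::euclidean_space set \<Rightarrow> ('a \<Rightarrow> real) \<Rightarrow> 'a \<Rightarrow> real \<Rightarrow> real \<Rightarrow> bool" where
  "globally_holder_at X g x H \<nu> \<longleftrightarrow>
     0 < \<nu> \<and> (\<forall>y\<in>X. \<bar>g x - g y\<bar> \<le> H * norm (x - y) powr \<nu>)"

text \<open>The density is only relevant on X; the law of each observation is
  g times the indicator of X with respect to Lebesgue measure.\<close>

definition iid_with_density ::
  "'w measure \<Rightarrow> (nat \<Rightarrow> 'w \<Rightarrow> 'a::euclidean_space) \<Rightarrow> 'a set \<Rightarrow> ('a \<Rightarrow> real) \<Rightarrow> bool" where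
  "iid_with_density M obs X g \<longleftrightarrow>
     prob_space.indep_vars M (\<lambda>_. borel) obs UNIV \<and>
     (\<forall>t. distributed M lborel (obs t) (\<lambda>y. ennreal (indicator X y * g y)))"

text \<open>The estimates along a fixed realisation \<open>\<omega>s\<close> of the observation sequence.\<close>

primrec sqg ::
  "('a::euclidean_space \<Rightarrow> real) \<Rightarrow> ('a \<Rightarrow> real) \<Rightarrow> ('a \<Rightarrow> real) \<Rightarrow> (nat \<Rightarrow> real) \<Rightarrow> (nat \<Rightarrow> real) \<Rightarrow>
   'a \<Rightarrow> real \<Rightarrow> (nat \<Rightarrow> 'a) \<Rightarrow> nat \<Rightarrow> real" where
  "sqg gl gu K \<rho> \<theta> x z0 \<omega>s 0 = z0"
| "sqg gl gu K \<rho> \<theta> x z0 \<omega>s (Suc t) =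
     (let z = sqg gl gu K \<rho> \<theta> x z0 \<omega>s t;
          \<xi> = z - 1 / \<theta> t ^ DIM('a) * K ((\<omega>s t - x) /\<^sub>R \<theta> t)
      in min (gu x) (max (gl x) (z - \<rho> t * \<xi>)))"

definition cesaro :: "(nat \<Rightarrow> real) \<Rightarrow> (nat \<Rightarrow> real) \<Rightarrow> nat \<Rightarrow> real" where
  "cesaro \<rho> z t = (\<Sum>j\<le>t. \<rho> j * z j) / (\<Sum>j\<le>t. \<rho> j)"

text \<open>Boundary condition, vacuous for \<open>X = UNIV\<close> and whenever the kernel windows around x stay
  inside X.  Points outside X at which the window puts mass contribute the value 0 to the mean of
  the kernel estimate; there the Hoelder bound is required of g extended by 0.  For a proper subset
  X the Hoelder condition on X alone does not control the bias near the boundary: with X the unit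
  interval, g and K equal to its indicator, x = 1 and all \<open>\<theta> t = 1\<close>, the kernel terms vanish almost
  surely, so the estimates tend to 0 (if \<open>gl x = 0\<close>, the \<open>\<rho> t < 1\<close> sum to infinity) rather
  than to \<open>g x = 1\<close>, although g is Hoelder on X with constant 0.\<close>

definition boundary_compatible ::
  "'a::euclidean_space set \<Rightarrow> ('a \<Rightarrow> real) \<Rightarrow> ('a \<Rightarrow> real) \<Rightarrow> (nat \<Rightarrow> real) \<Rightarrow> 'a \<Rightarrow> real \<Rightarrow> real \<Rightarrow> bool"
  where
  "boundary_compatible X g K \<theta> x H \<nu> \<longleftrightarrow>
     (\<forall>t. AE y in lborel. y \<notin> X \<and> K ((y - x) /\<^sub>R \<theta> t) \<noteq> 0 \<longrightarrow> \<bar>g x - 0\<bar> \<le> H * norm (x - y) powr \<nu>)"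

lemma boundary_compatible_UNIV: "boundary_compatible UNIV g K \<theta> x H \<nu>"
  by (simp add: boundary_compatible_def)

lemma boundary_compatible_window:
  assumes "\<And>t y. K ((y - x) /\<^sub>R \<theta> t) \<noteq> 0 \<Longrightarrow> y \<in> X"
  shows "boundary_compatible X g K \<theta> x H \<nu>"
  using assms by (auto simp: boundary_compatible_def)

end

theory Submission
  imports Defs
begin

text \<open>
  Clipping to an interval containing \<open>g x\<close> does not increase the distance to \<open>g x\<close>, so each step
  bounds \<open>\<rho> t * (z t - g x)\<^sup>2\<close> by half the decrease of \<open>(z t - g x)\<^sup>2\<close>, plus a bias term, a quadratic
  term and the noise \<open>\<rho> t * (z t - g x) * (k t - m t)\<close>, where \<open>k t\<close> is the kernel value with mean
  \<open>m t\<close>.  Summing telescopes, and convexity of the square passes to the weighted mean.  The noise is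
  a martingale difference, since \<open>z t\<close> depends only on the observations before time \<open>t\<close>, so its sum
  is centred and its variance is the sum of the variances of its terms.
\<close>

section \<open>The recursion: range, dependence on the past, measurability\<close>

lemma sqg_bounds:
  assumes "gl x \<le> gu x" and "z0 \<in> {gl x..gu x}"
  shows "sqg gl gu K \<rho> \<theta> x z0 \<omega>s t \<in> {gl x..gu x}"
  using assms by (cases t) (auto simp: Let_def)

text \<open>The strict inequality \<open>i < t\<close> expresses predictability. It allows a
  sequence to be replaced by its restriction to \<open>{..<t}\<close>, whose other values are
  \<open>undefined\<close>.\<close>

lemma sqg_cong:
  assumes "\<And>i. i < t \<Longrightarrow> \<omega>s i = \<omega>s' i"
  shows "sqg gl gu K \<rho> \<theta> x z0 \<omega>s t = sqg gl gu K \<rho> \<theta> x z0 \<omega>s' t"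
  using assms by (induction t) (auto simp: Let_def)

text \<open>The space \<open>M\<close> and the map \<open>X\<close> are left general because two
  cases occur: the finite product over past times, where only the coordinates before
  \<open>t\<close> are available, and the sample space itself.\<close>

lemma sqg_measurable:
  assumes K[measurable]: "K \<in> borel_measurable borel"
    and X: "\<And>i. i < t \<Longrightarrow> (\<lambda>\<omega>. X \<omega> i) \<in> borel_measurable M"
  shows "(\<lambda>\<omega>. sqg gl gu K \<rho> \<theta> x z0 (X \<omega>) t) \<in> borel_measurable M"
  using X
proof (induction t)
  case (Suc t)
  have [measurable]: "(\<lambda>\<omega>. X \<omega> t) \<in> borel_measurable M"
    and [measurable]: "(\<lambda>\<omega>. sqg gl gu K \<rho> \<theta> x z0 (X \<omega>) t) \<in> borel_measurable M"
    using Suc by auto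
  show ?case by (simp add: Let_def)
qed simp

section \<open>The deterministic energy inequality along one realisation\<close>

lemma clip_nonexpansive:
  fixes a b c w :: real
  assumes "a \<le> c" "c \<le> b"
  shows "(min b (max a w) - c)\<^sup>2 \<le> (w - c)\<^sup>2"
proof -
  have "\<bar>min b (max a w) - c\<bar> \<le> \<bar>w - c\<bar>" using assms by auto
  then show ?thesis by (simp add: abs_le_square_iff)
qed

text \<open>Jensen's inequality for the square: expand the nonnegative weighted sum of squared
  deviations from the mean \<open>c\<close>.\<close>

lemma weighted_mean_square_le:
  fixes w d :: "'i \<Rightarrow> real"
  assumes S: "0 < sum w I" and w: "\<And>i. i \<in> I \<Longrightarrow> 0 \<le> w i"
  shows "((\<Sum>i\<in>I. w i * d i) / sum w I)\<^sup>2 \<le> (\<Sum>i\<in>I. w i * (d i)\<^sup>2) / sum w I"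
proof -
  define c where "c = (\<Sum>i\<in>I. w i * d i) / sum w I"
  have cS: "(\<Sum>i\<in>I. w i * d i) = c * sum w I" using S by (simp add: c_def)
  have "0 \<le> (\<Sum>i\<in>I. w i * (d i - c)\<^sup>2)" by (intro sum_nonneg mult_nonneg_nonneg w) auto
  also have "\<dots> = (\<Sum>i\<in>I. w i * (d i)\<^sup>2) - 2 * c * (\<Sum>i\<in>I. w i * d i) + c\<^sup>2 * sum w I"
    by (simp add: power2_diff algebra_simps sum.distrib sum_subtractf sum_distrib_left sum_distrib_right)
  also have "\<dots> = (\<Sum>i\<in>I. w i * (d i)\<^sup>2) - c\<^sup>2 * sum w I"
    unfolding cS by (simp add: power2_eq_square)
  finally show ?thesis unfolding c_def[symmetric] using S by (simp add: pos_le_divide_eq)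
qed

text \<open>Expand the square of the unclipped step using
  \<open>z - k = (z - g) - (m - g) - (k - m)\<close>. The first part gives the decrease, the second
  the bias, and the third is kept as noise.\<close>

lemma clipped_step_energy:
  fixes u z g k m \<rho> a b \<beta> \<kappa> :: real
  assumes u: "u = min b (max a (z - \<rho> * (z - k)))"
    and a: "0 \<le> a" and z: "z \<in> {a..b}" and g: "g \<in> {a..b}" and k: "0 \<le> k" "k \<le> \<kappa>"
    and m: "\<bar>m - g\<bar> \<le> \<beta>" and \<rho>: "0 \<le> \<rho>"
  shows "\<rho> * (z - g)\<^sup>2 \<le> ((z - g)\<^sup>2 - (u - g)\<^sup>2) / 2 + b * (\<rho> * \<beta>)
           + \<rho>\<^sup>2 * b\<^sup>2 / 2 + \<rho>\<^sup>2 * \<kappa>\<^sup>2 / 2 + \<rho> * ((z - g) * (k - m))"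
proof -
  have "(u - g)\<^sup>2 \<le> (z - \<rho> * (z - k) - g)\<^sup>2"
    unfolding u using g by (intro clip_nonexpansive) auto
  also have "\<dots> = (z - g)\<^sup>2 - 2 * \<rho> * (z - g)\<^sup>2 + 2 * \<rho> * ((z - g) * (m - g))
      + 2 * \<rho> * ((z - g) * (k - m)) + \<rho>\<^sup>2 * (z - k)\<^sup>2"
    by (simp add: power2_eq_square algebra_simps)
  finally have 1: "2 * (\<rho> * (z - g)\<^sup>2) \<le> (z - g)\<^sup>2 - (u - g)\<^sup>2
      + 2 * (\<rho> * ((z - g) * (m - g))) + 2 * (\<rho> * ((z - g) * (k - m))) + \<rho>\<^sup>2 * (z - k)\<^sup>2"
    by simp
  have "(z - g) * (m - g) \<le> \<bar>z - g\<bar> * \<bar>m - g\<bar>" by (metis abs_ge_self abs_mult)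
  also have "\<dots> \<le> b * \<beta>" using a z g m by (intro mult_mono) auto
  finally have "\<rho> * ((z - g) * (m - g)) \<le> \<rho> * (b * \<beta>)" using \<rho> by (rule mult_left_mono)
  then have 2: "\<rho> * ((z - g) * (m - g)) \<le> b * (\<rho> * \<beta>)" by (simp add: mult.left_commute)
  have "(z - k)\<^sup>2 \<le> z\<^sup>2 + k\<^sup>2" using a z k by (simp add: power2_diff)
  also have "\<dots> \<le> b\<^sup>2 + \<kappa>\<^sup>2" using a z k by (intro add_mono power_mono) auto
  finally have "\<rho>\<^sup>2 * (z - k)\<^sup>2 \<le> \<rho>\<^sup>2 * b\<^sup>2 + \<rho>\<^sup>2 * \<kappa>\<^sup>2"
    using mult_left_mono[of "(z - k)\<^sup>2" "b\<^sup>2 + \<kappa>\<^sup>2" "\<rho>\<^sup>2"] by (simp add: distrib_left)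
  with 1 2 show ?thesis by argo
qed

text \<open>Entirely pathwise: the \<open>m i\<close> are arbitrary reference values within
  \<open>\<beta> i\<close> of \<open>g\<close>, and the last sum is left unestimated. Probability
  enters only when \<open>m i\<close> becomes the mean of the kernel value and this sum the
  martingale.\<close>

lemma sqg_cesaro_energy:
  fixes x :: "'a::euclidean_space" and \<omega>s :: "nat \<Rightarrow> 'a" and gl gu K :: "'a \<Rightarrow> real"
    and \<rho> \<theta> m \<beta> \<kappa> :: "nat \<Rightarrow> real" and z0 :: real
  defines "z \<equiv> sqg gl gu K \<rho> \<theta> x z0 \<omega>s"
    and "k \<equiv> \<lambda>i. 1 / \<theta> i ^ DIM('a) * K ((\<omega>s i - x) /\<^sub>R \<theta> i)"
  assumes gl: "0 \<le> gl x" and g: "g \<in> {gl x..gu x}" and z0: "z0 \<in> {gl x..gu x}"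
    and \<rho>: "\<And>i. 0 \<le> \<rho> i" "0 < \<rho> 0"
    and m: "\<And>i. \<bar>m i - g\<bar> \<le> \<beta> i"
    and k: "\<And>i. 0 \<le> k i" "\<And>i. k i \<le> \<kappa> i"
  shows "\<bar>cesaro \<rho> z t - g\<bar>\<^sup>2 \<le>
      (1/2 * (z0 - g)\<^sup>2 + 2 * gu x * (\<Sum>i\<le>t. \<rho> i * \<beta> i) + (gu x)\<^sup>2 * (\<Sum>i\<le>t. (\<rho> i)\<^sup>2)
        + (\<Sum>i\<le>t. (\<rho> i)\<^sup>2 * (\<kappa> i)\<^sup>2)) / (\<Sum>i\<le>t. \<rho> i)
      + (\<Sum>i\<le>t. \<rho> i * ((z i - g) * (k i - m i))) / (\<Sum>i\<le>t. \<rho> i)"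
proof -
  let ?S = "\<Sum>i\<le>t. \<rho> i"
  have S: "0 < ?S" using \<rho> by (intro sum_pos2[of _ 0]) auto
  have z: "z i \<in> {gl x..gu x}" for i
    unfolding z_def using g z0 by (intro sqg_bounds) auto
  have step: "\<rho> i * (z i - g)\<^sup>2 \<le> ((z i - g)\<^sup>2 - (z (Suc i) - g)\<^sup>2) / 2 + gu x * (\<rho> i * \<beta> i)
      + (\<rho> i)\<^sup>2 * (gu x)\<^sup>2 / 2 + (\<rho> i)\<^sup>2 * (\<kappa> i)\<^sup>2 / 2 + \<rho> i * ((z i - g) * (k i - m i))" for i
    by (rule clipped_step_energy[OF _ gl z g k m \<rho>(1)]) (simp add: z_def k_def Let_def)
  have tele: "(\<Sum>i\<le>t. ((z i - g)\<^sup>2 - (z (Suc i) - g)\<^sup>2) / 2) = ((z 0 - g)\<^sup>2 - (z (Suc t) - g)\<^sup>2) / 2"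
    by (induction t) (auto simp: field_simps)
  have "(\<Sum>i\<le>t. \<rho> i * (z i - g)\<^sup>2) \<le>
      ((z 0 - g)\<^sup>2 - (z (Suc t) - g)\<^sup>2) / 2 + gu x * (\<Sum>i\<le>t. \<rho> i * \<beta> i)
      + (gu x)\<^sup>2 * (\<Sum>i\<le>t. (\<rho> i)\<^sup>2) / 2 + (\<Sum>i\<le>t. (\<rho> i)\<^sup>2 * (\<kappa> i)\<^sup>2) / 2
      + (\<Sum>i\<le>t. \<rho> i * ((z i - g) * (k i - m i)))"
    using sum_mono[where K = "{..t}" and f = "\<lambda>i. \<rho> i * (z i - g)\<^sup>2", OF step] unfolding sum.distrib tele
    by (simp add: sum_distrib_left sum_divide_distrib mult.commute)
  \<comment> \<open>The telescoped bound has smaller constants; the final squared distance is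
    discarded and the nonnegative terms are enlarged to the coefficients of the claim.\<close>
  also have "\<dots> \<le> (1/2 * (z0 - g)\<^sup>2 + 2 * gu x * (\<Sum>i\<le>t. \<rho> i * \<beta> i)
      + (gu x)\<^sup>2 * (\<Sum>i\<le>t. (\<rho> i)\<^sup>2) + (\<Sum>i\<le>t. (\<rho> i)\<^sup>2 * (\<kappa> i)\<^sup>2))
      + (\<Sum>i\<le>t. \<rho> i * ((z i - g) * (k i - m i)))"
  proof -
    have "0 \<le> \<beta> i" for i using m[of i] by linarith
    then have "0 \<le> gu x * (\<Sum>i\<le>t. \<rho> i * \<beta> i)"
      using gl g \<rho> by (intro mult_nonneg_nonneg sum_nonneg) auto
    moreover have "0 \<le> (gu x)\<^sup>2 * (\<Sum>i\<le>t. (\<rho> i)\<^sup>2)" "0 \<le> (\<Sum>i\<le>t. (\<rho> i)\<^sup>2 * (\<kappa> i)\<^sup>2)"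
      by (auto intro!: mult_nonneg_nonneg sum_nonneg)
    moreover have "((z 0 - g)\<^sup>2 - (z (Suc t) - g)\<^sup>2) / 2 \<le> 1/2 * (z0 - g)\<^sup>2" by (simp add: z_def)
    ultimately show ?thesis by argo
  qed
  finally have energy: "(\<Sum>i\<le>t. \<rho> i * (z i - g)\<^sup>2) \<le> \<dots>" .
  have "cesaro \<rho> z t - g = (\<Sum>i\<le>t. \<rho> i * (z i - g)) / ?S"
    using S by (simp add: cesaro_def right_diff_distrib sum_subtractf sum_distrib_right[symmetric]
        diff_divide_distrib)
  then have "\<bar>cesaro \<rho> z t - g\<bar>\<^sup>2 \<le> (\<Sum>i\<le>t. \<rho> i * (z i - g)\<^sup>2) / ?S"
    unfolding power2_abs using weighted_mean_square_le[of \<rho> "{..t}" "\<lambda>i. z i - g"] S \<rho> by simp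
  also note divide_right_mono[OF energy less_imp_le[OF S]]
  finally show ?thesis by (simp add: add_divide_distrib)
qed

section \<open>Predictable sums of independent centred terms\<close>

lemma (in prob_space) expectation_past_times_present:
  fixes X :: "nat \<Rightarrow> 'a \<Rightarrow> 'b" and q :: "(nat \<Rightarrow> 'b) \<Rightarrow> real" and f :: "'b \<Rightarrow> real"
  assumes indep: "indep_vars (\<lambda>_. N) X UNIV"
    and q[measurable]: "q \<in> borel_measurable (PiM {..<n} (\<lambda>_. N))"
    and f[measurable]: "f \<in> borel_measurable N"
    and int: "integrable M (\<lambda>\<omega>. q (restrict (\<lambda>i. X i \<omega>) {..<n}))" "integrable M (\<lambda>\<omega>. f (X n \<omega>))"
  shows "expectation (\<lambda>\<omega>. q (restrict (\<lambda>i. X i \<omega>) {..<n}) * f (X n \<omega>)) =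
      expectation (\<lambda>\<omega>. q (restrict (\<lambda>i. X i \<omega>) {..<n})) * expectation (\<lambda>\<omega>. f (X n \<omega>))"
proof -
  have "indep_var (PiM {..<n} (\<lambda>_. N)) (\<lambda>\<omega>. restrict (\<lambda>i. X i \<omega>) {..<n})
      (PiM {n} (\<lambda>_. N)) (\<lambda>\<omega>. restrict (\<lambda>i. X i \<omega>) {n})"
    by (rule indep_var_restrict[OF indep]) auto
  \<comment> \<open>The index blocks \<open>{..<n}\<close> and \<open>{n}\<close> are disjoint,
    hence independent; composing with \<open>q\<close> and with evaluation at \<open>n\<close>
    preserves this.\<close>
  then have "indep_var borel (q \<circ> (\<lambda>\<omega>. restrict (\<lambda>i. X i \<omega>) {..<n}))
      borel ((\<lambda>v. f (v n)) \<circ> (\<lambda>\<omega>. restrict (\<lambda>i. X i \<omega>) {n}))"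
    by (rule indep_var_compose) measurable
  then have "indep_var borel (\<lambda>\<omega>. q (restrict (\<lambda>i. X i \<omega>) {..<n})) borel (\<lambda>\<omega>. f (X n \<omega>))"
    by (simp add: o_def)
  from indep_var_lebesgue_integral[OF this int] show ?thesis .
qed

text \<open>Increments of a martingale are orthogonal, so the second moment of the sum grows only by
  the diagonal terms. The weights \<open>p j\<close> take whole sequences, with \<open>past\<close>
  recording that they see only times before \<open>j\<close>; the bounds \<open>C\<close> secure
  integrability, while \<open>B\<close> and \<open>v\<close> give the variance bound.\<close>

lemma (in prob_space) predictable_transform:
  fixes X :: "nat \<Rightarrow> 'a \<Rightarrow> 'b" and p :: "nat \<Rightarrow> (nat \<Rightarrow> 'b) \<Rightarrow> real" and h :: "nat \<Rightarrow> 'b \<Rightarrow> real"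
  assumes indep: "indep_vars (\<lambda>_. N) X UNIV"
    and p: "\<And>j. p j \<in> borel_measurable (PiM {..<j} (\<lambda>_. N))"
    and past: "\<And>j v. p j (restrict v {..<j}) = p j v"
    and B: "\<And>j v. \<bar>p j v\<bar> \<le> B j"
    and h: "\<And>j. h j \<in> borel_measurable N"
    and C: "\<And>j y. \<bar>h j y\<bar> \<le> C j"
    and mean: "\<And>j. expectation (\<lambda>\<omega>. h j (X j \<omega>)) = 0"
    and var: "\<And>j. expectation (\<lambda>\<omega>. (h j (X j \<omega>))\<^sup>2) \<le> v j"
  defines "S \<equiv> \<lambda>n \<omega>. \<Sum>j<n. p j (\<lambda>i. X i \<omega>) * h j (X j \<omega>)"
  shows "integrable M (S n)" (is ?int) and "integrable M (\<lambda>\<omega>. (S n \<omega>)\<^sup>2)" (is ?int2)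
    and "expectation (S n) = 0" (is ?mean)
    and "expectation (\<lambda>\<omega>. (S n \<omega>)\<^sup>2) \<le> (\<Sum>j<n. (B j)\<^sup>2 * v j)" (is ?var)
proof -
  have X[measurable]: "random_variable N (X i)" for i
    using indep by (auto simp: indep_vars_def2)
  note h[measurable]
  \<comment> \<open>Measurability passes to a longer history by first restricting to
    \<open>{..<j}\<close>, which leaves the value of \<open>p j\<close> unchanged.\<close>
  have p_le[measurable]: "(\<lambda>u. p j u) \<in> borel_measurable (PiM {..<n} (\<lambda>_. N))" if "j \<le> n" for j n
  proof -
    have "(\<lambda>u. p j (restrict u {..<j})) \<in> borel_measurable (PiM {..<n} (\<lambda>_. N))"
      by (rule measurable_compose[OF measurable_restrict_subset p]) (use that in auto)
    then show ?thesis by (simp add: past)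
  qed
  have pX[measurable]: "(\<lambda>\<omega>. p j (\<lambda>i. X i \<omega>)) \<in> borel_measurable M" for j
  proof -
    have "(\<lambda>\<omega>. p j (restrict (\<lambda>i. X i \<omega>) {..<j})) \<in> borel_measurable M"
      by (rule measurable_compose[OF measurable_restrict p]) auto
    then show ?thesis by (simp add: past)
  qed
  have B0: "0 \<le> B j" for j using B[of j undefined] by linarith
  have SB: "\<bar>\<Sum>j<n. p j u * h j (u j)\<bar> \<le> (\<Sum>j<n. B j * C j)" for n and u :: "nat \<Rightarrow> 'b"
    by (rule order_trans[OF sum_abs]) (auto intro!: sum_mono mult_mono B C B0 simp: abs_mult)
  have S_meas[measurable]: "S n \<in> borel_measurable M" for n unfolding S_def by measurable
  have S_bd: "\<bar>S n \<omega>\<bar> \<le> (\<Sum>j<n. B j * C j)" for n \<omega> unfolding S_def by (rule SB)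
  have bdd_int: "integrable M f" if "f \<in> borel_measurable M" "\<And>\<omega>. \<bar>f \<omega>\<bar> \<le> b" for f :: "'a \<Rightarrow> real" and b
    by (rule integrable_const_bound[of _ b]) (use that in auto)
  show int: ?int by (rule bdd_int[OF S_meas S_bd])
  show ?int2 by (rule bdd_int[of _ "(\<Sum>j<n. B j * C j)\<^sup>2"])
      (auto simp: abs_le_square_iff[symmetric] intro: order_trans[OF S_bd])
  have h_int: "integrable M (\<lambda>\<omega>. h j (X j \<omega>))" for j
    by (rule bdd_int[of _ "C j"]) (auto intro: C)
  have D_bd: "\<bar>p j (\<lambda>i. X i \<omega>) * h j (X j \<omega>)\<bar> \<le> B j * C j" for j \<omega>
    by (auto intro!: mult_mono B C B0 simp: abs_mult)
  have D_int: "integrable M (\<lambda>\<omega>. p j (\<lambda>i. X i \<omega>) * h j (X j \<omega>))" for j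
    by (rule bdd_int[OF _ D_bd]) measurable
  have D_mean: "expectation (\<lambda>\<omega>. p j (\<lambda>i. X i \<omega>) * h j (X j \<omega>)) = 0" for j
  proof -
    have "integrable M (\<lambda>\<omega>. p j (\<lambda>i. X i \<omega>))" by (rule bdd_int[OF _ B]) measurable
    then show ?thesis
      using expectation_past_times_present[OF indep p[of j] h[of j]] mean h_int by (simp add: past)
  qed
  show ?mean unfolding S_def using D_int D_mean by (simp add: integral_sum)
  show ?var
  proof (induction n)
    case 0
    show ?case by (simp add: S_def)
  next
    case (Suc n)
    let ?D = "\<lambda>\<omega>. p n (\<lambda>i. X i \<omega>) * h n (X n \<omega>)"
    \<comment> \<open>This is the partial sum times the next weight as a function of the first
      \<open>n\<close> observations, so the cross term has the form past times present.\<close>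
    let ?q = "\<lambda>u. (\<Sum>j<n. p j u * h j (u j)) * p n u"
    have q[measurable]: "?q \<in> borel_measurable (PiM {..<n} (\<lambda>_. N))"
    proof -
      have "(\<lambda>u. p j u * h j (u j)) \<in> borel_measurable (PiM {..<n} (\<lambda>_. N))" if "j < n" for j
        using measurable_component_singleton[of j "{..<n}" "\<lambda>_. N"] that
        by (intro borel_measurable_times p_le measurable_compose[OF _ h]) auto
      then show ?thesis using p by (intro borel_measurable_times borel_measurable_sum) auto
    qed
    have q_past: "?q (restrict (\<lambda>i. X i \<omega>) {..<n}) = S n \<omega> * p n (\<lambda>i. X i \<omega>)" for \<omega>
    proof -
      \<comment> \<open>Restricting to \<open>{..<n}\<close> and then to the smaller
        \<open>{..<j}\<close> is the same as restricting to \<open>{..<j}\<close> at once.\<close>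
      have "p j (restrict (\<lambda>i. X i \<omega>) {..<n}) = p j (\<lambda>i. X i \<omega>)" if "j < n" for j
        using that past[of j "restrict (\<lambda>i. X i \<omega>) {..<n}"] past[of j "\<lambda>i. X i \<omega>"]
        by (metis (no_types, lifting) Int_absorb1 lessThan_subset_iff less_imp_le restrict_restrict)
      then show ?thesis by (simp add: S_def past)
    qed
    have bd: "\<bar>S n \<omega> * p n (\<lambda>i. X i \<omega>)\<bar> \<le> (\<Sum>j<n. B j * C j) * B n" for \<omega>
      unfolding abs_mult by (intro mult_mono S_bd B) (auto intro: order_trans[OF abs_ge_zero S_bd])
    have qi: "integrable M (\<lambda>\<omega>. S n \<omega> * p n (\<lambda>i. X i \<omega>))" by (rule bdd_int[OF _ bd]) measurable
    have cross: "expectation (\<lambda>\<omega>. S n \<omega> * ?D \<omega>) = 0"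
      using expectation_past_times_present[OF indep q h[of n]] mean[of n] h_int qi
      unfolding q_past by (simp add: mult.assoc)
    have i1: "integrable M (\<lambda>\<omega>. (S n \<omega>)\<^sup>2)"
      by (rule bdd_int[of _ "(\<Sum>j<n. B j * C j)\<^sup>2"])
        (auto simp: abs_le_square_iff[symmetric] intro: order_trans[OF S_bd])
    have i2: "integrable M (\<lambda>\<omega>. (?D \<omega>)\<^sup>2)"
      by (rule bdd_int[of _ "(B n * C n)\<^sup>2"])
        (auto simp: abs_le_square_iff[symmetric] simp del: abs_mult intro: order_trans[OF D_bd])
    have i3: "integrable M (\<lambda>\<omega>. S n \<omega> * ?D \<omega>)"
      by (rule bdd_int[of _ "(\<Sum>j<n. B j * C j) * (B n * C n)"], measurable)
        (subst abs_mult, auto intro!: mult_mono S_bd D_bd intro: order_trans[OF abs_ge_zero S_bd])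
    have i4: "integrable M (\<lambda>\<omega>. (h n (X n \<omega>))\<^sup>2)"
      by (rule bdd_int[of _ "(C n)\<^sup>2"])
        (auto simp: abs_le_square_iff[symmetric] intro: order_trans[OF C])
    have "expectation (\<lambda>\<omega>. (S (Suc n) \<omega>)\<^sup>2) =
        expectation (\<lambda>\<omega>. (S n \<omega>)\<^sup>2 + 2 * (S n \<omega> * ?D \<omega>) + (?D \<omega>)\<^sup>2)"
      by (intro Bochner_Integration.integral_cong refl)
        (simp add: S_def power2_eq_square algebra_simps)
    also have "\<dots> = expectation (\<lambda>\<omega>. (S n \<omega>)\<^sup>2) + expectation (\<lambda>\<omega>. (?D \<omega>)\<^sup>2)"
      using i1 i2 i3 cross by simp
    \<comment> \<open>In the diagonal term the weight is bounded pointwise by \<open>B n\<close>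
      before taking expectations, so independence is used for the cross term alone.\<close>
    also have "expectation (\<lambda>\<omega>. (?D \<omega>)\<^sup>2) \<le> expectation (\<lambda>\<omega>. (B n)\<^sup>2 * (h n (X n \<omega>))\<^sup>2)"
      using i2 i4 B[of n] B0[of n]
      by (intro integral_mono) (auto simp: power_mult_distrib abs_le_square_iff[symmetric] intro!: mult_right_mono)
    also have "\<dots> \<le> (B n)\<^sup>2 * v n" using i4 var[of n] by (simp add: mult_left_mono)
    finally show ?case using Suc by simp
  qed
qed

section \<open>Rescaled kernels: change of variables, bias and second moment\<close>

lemma lborel_eq_density_rescale:
  fixes x :: "'a::euclidean_space"
  assumes "0 < c"
  shows "lborel = density (distr lborel borel (\<lambda>y. (y - x) /\<^sub>R c)) (\<lambda>_. ennreal (1 / c ^ DIM('a)))"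
  \<comment> \<open>Scale \<open>1 / c\<close> and offset \<open>- (x /\<^sub>R c)\<close> give the
    affine map \<open>(y - x) /\<^sub>R c\<close>, whose Jacobian is
    \<open>1 / c ^ DIM('a)\<close>.\<close>
  using lborel_affine[of "1 / c" "- (x /\<^sub>R c)"] assms
  by (simp add: scaleR_diff_right inverse_eq_divide power_one_over)

lemma has_bochner_integral_rescale:
  fixes f :: "'a::euclidean_space \<Rightarrow> real"
  assumes f: "has_bochner_integral lborel f I" and c: "0 < c"
  shows "has_bochner_integral lborel (\<lambda>y. 1 / c ^ DIM('a) * f ((y - x) /\<^sub>R c)) I"
proof -
  have [measurable]: "f \<in> borel_measurable borel"
    using f by (auto simp: has_bochner_integral_iff)
  have "has_bochner_integral
      (density (distr lborel borel (\<lambda>y. (y - x) /\<^sub>R c)) (\<lambda>_. ennreal (1 / c ^ DIM('a)))) f I"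
    using f by (simp only: lborel_eq_density_rescale[OF c, symmetric])
  then show ?thesis
    using c by (simp add: has_bochner_integral_iff integrable_density integral_density
        integrable_distr_eq integral_distr)
qed

lemma AE_lborel_rescale:
  fixes P :: "'a::euclidean_space \<Rightarrow> bool"
  assumes P: "AE u in lborel. P u" and [measurable]: "Measurable.pred borel P" and c: "0 < c"
  shows "AE y in lborel. P ((y - x) /\<^sub>R c)"
proof -
  have "AE u in density (distr lborel borel (\<lambda>y. (y - x) /\<^sub>R c)) (\<lambda>_. ennreal (1 / c ^ DIM('a))). P u"
    using P by (simp only: lborel_eq_density_rescale[OF c, symmetric])
  then show ?thesis using c by (simp add: AE_density AE_distr_iff)
qed

text \<open>A law with a density against \<open>N\<close> charges no \<open>N\<close>-null set. This
  transfers almost-everywhere kernel bounds to the random observations.\<close>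

lemma distributed_AE_lborel:
  assumes D: "distributed M N X f" and P: "AE y in N. P y"
  shows "AE \<omega> in M. P (X \<omega>)"
proof -
  have "AE y in density N f. P y"
    using P distributed_borel_measurable[OF D] by (auto simp: AE_density elim: eventually_mono)
  then have "AE y in distr M N X. P y" unfolding distributed_distr_eq_density[OF D] .
  then show ?thesis by (rule AE_distrD[OF distributed_measurable[OF D]])
qed

text \<open>The whole space and \<open>X\<close> carry the same mass 1, so the nonnegative
  difference of \<open>K\<close> and its restriction to \<open>X\<close> integrates to 0.\<close>

lemma density_on_AE_zero_outside:
  assumes K: "density_on UNIV K" and X: "X \<in> sets borel" and 1: "(LINT y:X|lborel. K y) = 1"
  shows "AE y in lborel. y \<notin> X \<longrightarrow> K y = 0"
proof -
  have K0: "0 \<le> K y" for y using K by (auto simp: density_on_def)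
  have Ki: "integrable lborel K" and K1: "integral\<^sup>L lborel K = 1"
    using K by (auto simp: density_on_def set_integrable_def set_lebesgue_integral_def)
  have Xi: "integrable lborel (\<lambda>y. indicator X y * K y)"
    using integrable_mult_indicator[of X lborel K] X Ki by simp
  have "integral\<^sup>L lborel (\<lambda>y. K y - indicator X y * K y) = 0"
    using 1 Ki Xi K1 by (simp add: set_lebesgue_integral_def)
  moreover have "AE y in lborel. 0 \<le> K y - indicator X y * K y"
    using K0 by (auto simp: indicator_def)
  ultimately have "AE y in lborel. K y - indicator X y * K y = 0"
    using Ki Xi integral_nonneg_eq_0_iff_AE[of lborel "\<lambda>y. K y - indicator X y * K y"] by simp
  then show ?thesis by eventually_elim auto
qed

text \<open>The supremum runs over \<open>X\<close>, whereas window arguments may leave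
  \<open>X\<close>; there the kernel vanishes almost everywhere. Boundedness of the range makes the
  real-valued \<open>SUP\<close> a genuine upper bound.\<close>

lemma density_on_AE_le_SUP:
  assumes K: "density_on UNIV K" "bounded (range K)" and X: "X \<in> sets borel" "X \<noteq> {}"
    and 1: "(LINT y:X|lborel. K y) = 1" and le: "(SUP y\<in>X. K y) \<le> b"
  shows "0 \<le> b" and "AE y in lborel. K y \<le> b"
proof -
  have "bdd_above (K ` X)"
    using bounded_imp_bdd_above[OF K(2)] by (rule bdd_above_mono) auto
  then have X_le: "K y \<le> b" if "y \<in> X" for y
    using that le cSUP_upper[of y X K] by force
  then show b: "0 \<le> b"
    using X(2) K(1) by (auto simp: density_on_def dest: order_trans[rotated])
  show "AE y in lborel. K y \<le> b"
    using density_on_AE_zero_outside[OF K(1) X(1) 1] by eventually_elim (use X_le b in auto)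
qed

text \<open>Since the rescaled kernel has mass 1, the bias is the integral of \<open>f y - a\<close>
  against it. The bound on \<open>\<bar>a - f y\<bar>\<close> is required only where the window has
  mass, so \<open>f\<close> may be a density extended by 0.\<close>

lemma kernel_bias:
  fixes x :: "'a::euclidean_space" and f K :: "'a \<Rightarrow> real"
  assumes K: "density_on UNIV K" and c: "0 < c"
    and A: "integrable lborel (\<lambda>y. norm y powr \<nu> * K y)"
    and f[measurable]: "f \<in> borel_measurable borel" and fb: "\<And>y. \<bar>f y\<bar> \<le> b"
    and hoelder: "AE y in lborel. K ((y - x) /\<^sub>R c) \<noteq> 0 \<longrightarrow> \<bar>a - f y\<bar> \<le> H * norm (x - y) powr \<nu>"
  shows "\<bar>(LINT y|lborel. f y * (1 / c ^ DIM('a) * K ((y - x) /\<^sub>R c))) - a\<bar>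
      \<le> H * (LINT y|lborel. norm y powr \<nu> * K y) * c powr \<nu>"
proof -
  define k where "k y = 1 / c ^ DIM('a) * K ((y - x) /\<^sub>R c)" for y
  have K0: "0 \<le> K y" for y using K by (auto simp: density_on_def)
  have k0: "0 \<le> k y" for y using K0 c by (simp add: k_def)
  have "has_bochner_integral lborel k 1"
    unfolding k_def[abs_def] using K
    by (intro has_bochner_integral_rescale c)
      (simp add: density_on_def set_integrable_def set_lebesgue_integral_def has_bochner_integral_iff)
  then have ki: "integrable lborel k" and k1: "integral\<^sup>L lborel k = 1"
    by (simp_all add: has_bochner_integral_iff)
  have [measurable]: "k \<in> borel_measurable borel" using ki by auto
  \<comment> \<open>With \<open>u = (y - x) /\<^sub>R c\<close>, the distance
    \<open>norm (x - y)\<close> is \<open>c * norm u\<close>; this produces the factor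
    \<open>c powr \<nu>\<close>.\<close>
  have mom: "has_bochner_integral lborel (\<lambda>y. norm (x - y) powr \<nu> * k y)
      ((LINT y|lborel. norm y powr \<nu> * K y) * c powr \<nu>)"
  proof -
    have "has_bochner_integral lborel (\<lambda>y. norm y powr \<nu> * K y) (LINT y|lborel. norm y powr \<nu> * K y)"
      using A by (simp add: has_bochner_integral_iff)
    from has_bochner_integral_mult_left[OF has_bochner_integral_rescale[OF this c, of x], of "c powr \<nu>"]
    have "has_bochner_integral lborel
      (\<lambda>y. 1 / c ^ DIM('a) * (norm ((y - x) /\<^sub>R c) powr \<nu> * K ((y - x) /\<^sub>R c)) * c powr \<nu>)
      ((LINT y|lborel. norm y powr \<nu> * K y) * c powr \<nu>)"
      by simp
    moreover have "1 / c ^ DIM('a) * (norm ((y - x) /\<^sub>R c) powr \<nu> * K ((y - x) /\<^sub>R c)) * c powr \<nu>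
        = norm (x - y) powr \<nu> * k y" for y
    proof -
      have "norm ((y - x) /\<^sub>R c) = norm (x - y) / c"
        using c by (simp add: divide_inverse norm_minus_commute)
      then have "norm ((y - x) /\<^sub>R c) powr \<nu> * c powr \<nu> = norm (x - y) powr \<nu>"
        using c by (simp add: powr_divide)
      then show ?thesis by (simp add: k_def mult_ac)
    qed
    ultimately show ?thesis by simp
  qed
  have fk: "integrable lborel (\<lambda>y. f y * k y)"
    by (rule Bochner_Integration.integrable_bound[of _ "\<lambda>y. b * k y"])
      (use ki k0 fb in \<open>auto simp: abs_mult intro!: AE_I2 mult_right_mono order_trans[OF _ abs_ge_self]\<close>)
  have "(LINT y|lborel. f y * k y) - a = (LINT y|lborel. f y * k y - a * k y)"
    using fk ki k1 by simp
  also have "\<bar>\<dots>\<bar> \<le> (LINT y|lborel. \<bar>f y * k y - a * k y\<bar>)"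
    by (rule integral_abs_bound)
  also have "\<dots> \<le> (LINT y|lborel. H * (norm (x - y) powr \<nu> * k y))"
  proof (rule integral_mono_AE)
    show "AE y in lborel. \<bar>f y * k y - a * k y\<bar> \<le> H * (norm (x - y) powr \<nu> * k y)"
      using hoelder
    proof eventually_elim
      case (elim y)
      have "\<bar>f y * k y - a * k y\<bar> = \<bar>a - f y\<bar> * k y"
        using k0[of y] by (metis abs_minus_commute abs_mult abs_of_nonneg left_diff_distrib)
      also have "\<dots> \<le> H * norm (x - y) powr \<nu> * k y"
      proof (cases "K ((y - x) /\<^sub>R c) = 0")
        case True then show ?thesis by (simp add: k_def)
      next
        case False then show ?thesis using elim k0 by (intro mult_right_mono) auto
      qed
      finally show ?case by (simp add: mult.assoc)
    qed
  qed (use fk ki mom in \<open>auto simp: has_bochner_integral_iff\<close>)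
  also have "\<dots> = H * (LINT y|lborel. norm y powr \<nu> * K y) * c powr \<nu>"
    using mom by (simp add: has_bochner_integral_iff mult.assoc)
  finally show ?thesis by (simp add: k_def)
qed

text \<open>Bound \<open>f\<close> by \<open>b\<close> and one factor of the rescaled kernel by
  \<open>Kb / c ^ DIM('a)\<close>; the other factor integrates to 1. Hence only one power of
  \<open>c ^ DIM('a)\<close> appears.\<close>

lemma kernel_second_moment:
  fixes x :: "'a::euclidean_space" and f K :: "'a \<Rightarrow> real"
  assumes K: "density_on UNIV K" and c: "0 < c" and Kb: "AE y in lborel. K y \<le> Kb"
    and f[measurable]: "f \<in> borel_measurable borel" and f0: "\<And>y. 0 \<le> f y" and fb: "\<And>y. f y \<le> b"
  shows "(LINT y|lborel. f y * (1 / c ^ DIM('a) * K ((y - x) /\<^sub>R c))\<^sup>2) \<le> b * Kb / c ^ DIM('a)"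
proof -
  define k where "k y = 1 / c ^ DIM('a) * K ((y - x) /\<^sub>R c)" for y
  have K0: "0 \<le> K y" for y using K by (auto simp: density_on_def)
  have k0: "0 \<le> k y" for y using K0 c by (simp add: k_def)
  have "has_bochner_integral lborel k 1"
    unfolding k_def[abs_def] using K
    by (intro has_bochner_integral_rescale c)
      (simp add: density_on_def set_integrable_def set_lebesgue_integral_def has_bochner_integral_iff)
  then have ki: "integrable lborel k" and k1: "integral\<^sup>L lborel k = 1"
    by (simp_all add: has_bochner_integral_iff)
  have [measurable]: "k \<in> borel_measurable borel" using ki by auto
  have [measurable]: "K \<in> borel_measurable borel"
    using K by (simp add: density_on_def set_borel_measurable_def)
  have "AE y in lborel. K ((y - x) /\<^sub>R c) \<le> Kb"
    using Kb c by (intro AE_lborel_rescale) auto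
  then have le: "AE y in lborel. f y * (k y)\<^sup>2 \<le> b * Kb / c ^ DIM('a) * k y"
  proof eventually_elim
    case (elim y)
    have "k y \<le> Kb / c ^ DIM('a)" using elim c by (simp add: k_def divide_right_mono)
    moreover have "0 \<le> b" using f0[of y] fb[of y] by linarith
    ultimately have "f y * k y \<le> b * (Kb / c ^ DIM('a))"
      using f0 fb k0 by (intro mult_mono) auto
    from mult_right_mono[OF this k0[of y]] show ?case by (simp add: power2_eq_square mult.assoc)
  qed
  have "(LINT y|lborel. f y * (k y)\<^sup>2) \<le> (LINT y|lborel. b * Kb / c ^ DIM('a) * k y)"
  proof (rule integral_mono_AE[OF _ _ le])
    show "integrable lborel (\<lambda>y. f y * (k y)\<^sup>2)"
      by (rule Bochner_Integration.integrable_bound[of _ "\<lambda>y. b * Kb / c ^ DIM('a) * k y"])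
        (use ki le f0 in \<open>auto elim!: eventually_mono simp del: abs_divide times_divide_eq_left
            intro: order_trans[OF _ abs_ge_self]\<close>)
  qed (use ki in simp)
  also have "\<dots> = b * Kb / c ^ DIM('a)" using k1 by simp
  finally show ?thesis by (simp add: k_def)
qed

section \<open>Assembly: moments of the noise and the final estimate\<close>

theorem theorem6:
  fixes M :: "'w measure"
    and X :: "'a::euclidean_space set"
    and x :: 'a
    and g gl gu K :: "'a \<Rightarrow> real"
    and gbar Kbar H \<nu> A z0 :: real
    and \<rho> \<theta> :: "nat \<Rightarrow> real"
    and obs :: "nat \<Rightarrow> 'w \<Rightarrow> 'a"
    and z zbar :: "nat \<Rightarrow> 'w \<Rightarrow> real"
  assumes "prob_space M"
    and "X \<in> sets borel" and "x \<in> X"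
    and "g \<in> class_G X gl gu gbar"
    and "density_on X g"
    and "iid_with_density M obs X g"
    and "globally_holder_at X g x H \<nu>"
    and "density_on UNIV K" and "bounded (range K)"
    and "(LINT y:X|lborel. K y) = 1"
    and "(SUP y\<in>X. K y) \<le> Kbar"
    and "integrable lborel (\<lambda>y. norm y powr \<nu> * K y)"
    and "A = (LINT y|lborel. norm y powr \<nu> * K y)"
    and "\<And>t. 0 \<le> \<rho> t" and "0 < \<rho> 0" and "\<And>t. 0 < \<theta> t"
    and "boundary_compatible X g K \<theta> x H \<nu>"
    and "z0 \<in> {gl x..gu x}"
    and "\<And>t \<omega>. z t \<omega> = sqg gl gu K \<rho> \<theta> x z0 (\<lambda>j. obs j \<omega>) t"
    and "\<And>t \<omega>. zbar t \<omega> = cesaro \<rho> (\<lambda>j. z j \<omega>) t"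
  shows "\<exists>\<zeta> :: nat \<Rightarrow> 'w \<Rightarrow> real. \<forall>t.
    (\<forall>\<omega>\<in>space M. \<bar>zbar t \<omega> - g x\<bar>\<^sup>2 \<le>
        (1/2 * (z0 - g x)\<^sup>2
          + 2 * gu x * A * H * (\<Sum>i\<le>t. \<rho> i * \<theta> i powr \<nu>)
          + (gu x)\<^sup>2 * (\<Sum>i\<le>t. (\<rho> i)\<^sup>2)
          + Kbar\<^sup>2 * (\<Sum>i\<le>t. (\<rho> i)\<^sup>2 / \<theta> i ^ (2 * DIM('a))))
        / (\<Sum>i\<le>t. \<rho> i) + \<zeta> t \<omega>) \<and>
    integrable M (\<zeta> t) \<and> integrable M (\<lambda>\<omega>. (\<zeta> t \<omega>)\<^sup>2) \<and>
    prob_space.expectation M (\<zeta> t) = 0 \<and>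
    prob_space.variance M (\<zeta> t) \<le>
      gbar ^ 3 / (\<Sum>i\<le>t. \<rho> i)\<^sup>2
        * (gbar * (\<Sum>i\<le>t. (\<rho> i)\<^sup>2) + Kbar * (\<Sum>i\<le>t. (\<rho> i)\<^sup>2 / \<theta> i ^ DIM('a)))"
proof -
  interpret prob_space M by fact
  note X[measurable] = \<open>X \<in> sets borel\<close>
  have inG: "\<And>y. y \<in> X \<Longrightarrow> 0 \<le> gl y \<and> gl y \<le> g y \<and> g y \<le> gu y \<and> gu y \<le> gbar"
    using \<open>g \<in> class_G X gl gu gbar\<close> by (auto simp: class_G_def)
  have x: "0 \<le> gl x" "gl x \<le> g x" "g x \<le> gu x" "gu x \<le> gbar" using inG \<open>x \<in> X\<close> by auto
  have indep: "indep_vars (\<lambda>_. borel) obs UNIV"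
    and D: "\<And>t. distributed M lborel (obs t) (\<lambda>y. ennreal (indicator X y * g y))"
    using \<open>iid_with_density M obs X g\<close> by (auto simp: iid_with_density_def)
  have obs[measurable]: "obs t \<in> borel_measurable M" for t
    using indep by (auto simp: indep_vars_def2)
  have K_meas[measurable]: "K \<in> borel_measurable borel" and K0: "\<And>y. 0 \<le> K y"
    using \<open>density_on UNIV K\<close> by (auto simp: density_on_def set_borel_measurable_def)
  \<comment> \<open>\<open>Kmax\<close> bounds \<open>K\<close> at every point and serves
    integrability; the constants of the theorem come from \<open>Kbar\<close>, which is a bound
    almost everywhere.\<close>
  obtain Kmax where Kmax: "\<And>y. \<bar>K y\<bar> \<le> Kmax"
    using \<open>bounded (range K)\<close> by (auto simp: bounded_iff)
  \<comment> \<open>Extension by 0 turns \<open>g\<close> into the density of each observation on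
    the whole space.\<close>
  define f where "f y = indicator X y * g y" for y
  have f_meas[measurable]: "f \<in> borel_measurable borel"
    using \<open>density_on X g\<close> by (simp add: density_on_def set_borel_measurable_def f_def[abs_def])
  have f: "0 \<le> f y" "f y \<le> gbar" for y
    using inG[of y] x by (auto simp: f_def indicator_def)
  have E_obs: "expectation (\<lambda>\<omega>. \<phi> (obs t \<omega>)) = (LINT y|lborel. f y * \<phi> y)"
    if "\<phi> \<in> borel_measurable borel" for \<phi> t
    using distributed_integral[OF D[folded f_def], of \<phi> t] that f by simp
  define k where "k i y = 1 / \<theta> i ^ DIM('a) * K ((y - x) /\<^sub>R \<theta> i)" for i y
  have k_meas[measurable]: "k i \<in> borel_measurable borel" for i unfolding k_def[abs_def] by measurable
  have k0: "0 \<le> k i y" for i y using K0 \<open>0 < \<theta> i\<close> by (simp add: k_def)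
  have k_bd: "\<bar>k i y\<bar> \<le> Kmax / \<theta> i ^ DIM('a)" for i y
    using Kmax[of "(y - x) /\<^sub>R \<theta> i"] \<open>0 < \<theta> i\<close> by (simp add: k_def abs_mult divide_right_mono)
  define m where "m i = expectation (\<lambda>\<omega>. k i (obs i \<omega>))" for i
  have Kbar: "0 \<le> Kbar" "AE y in lborel. K y \<le> Kbar"
    using density_on_AE_le_SUP[OF \<open>density_on UNIV K\<close> \<open>bounded (range K)\<close> X _
        \<open>(LINT y:X|lborel. K y) = 1\<close> \<open>(SUP y\<in>X. K y) \<le> Kbar\<close>] \<open>x \<in> X\<close> by auto
  have bias: "\<bar>m i - g x\<bar> \<le> H * A * \<theta> i powr \<nu>" for i
  proof -
    \<comment> \<open>On \<open>X\<close> this is the Hoelder condition. Outside \<open>X\<close>,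
      where \<open>f y = 0\<close>, it is exactly what \<open>boundary_compatible\<close>
      supplies.\<close>
    have "AE y in lborel. K ((y - x) /\<^sub>R \<theta> i) \<noteq> 0 \<longrightarrow> \<bar>g x - f y\<bar> \<le> H * norm (x - y) powr \<nu>"
      using \<open>boundary_compatible X g K \<theta> x H \<nu>\<close>[unfolded boundary_compatible_def, rule_format, of i]
      by eventually_elim
        (use \<open>globally_holder_at X g x H \<nu>\<close> in \<open>auto simp: globally_holder_at_def f_def indicator_def\<close>)
    from kernel_bias[OF \<open>density_on UNIV K\<close> \<open>0 < \<theta> i\<close>
        \<open>integrable lborel (\<lambda>y. norm y powr \<nu> * K y)\<close> f_meas _ this, of gbar] f
    show ?thesis unfolding m_def E_obs[OF k_meas] by (simp add: k_def \<open>A = _\<close>)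
  qed
  have k_int: "integrable M (\<lambda>\<omega>. k i (obs i \<omega>))" for i
    by (rule integrable_const_bound[of _ "Kmax / \<theta> i ^ DIM('a)"]) (use k_bd in auto)
  have k2_int: "integrable M (\<lambda>\<omega>. (k i (obs i \<omega>))\<^sup>2)" for i
    by (rule integrable_const_bound[of _ "(Kmax / \<theta> i ^ DIM('a))\<^sup>2"])
      (use order_trans[OF k_bd abs_ge_self] in
        \<open>auto simp: abs_le_square_iff[symmetric] simp del: abs_divide\<close>)
  have k_var: "expectation (\<lambda>\<omega>. (k i (obs i \<omega>) - m i)\<^sup>2) \<le> gbar * Kbar / \<theta> i ^ DIM('a)" for i
  proof -
    have "expectation (\<lambda>\<omega>. (k i (obs i \<omega>) - m i)\<^sup>2) = expectation (\<lambda>\<omega>. (k i (obs i \<omega>))\<^sup>2) - (m i)\<^sup>2"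
      unfolding m_def by (rule variance_eq[OF k_int k2_int])
    also have "\<dots> \<le> expectation (\<lambda>\<omega>. (k i (obs i \<omega>))\<^sup>2)" by simp
    also have "\<dots> \<le> gbar * Kbar / \<theta> i ^ DIM('a)"
      using kernel_second_moment[OF \<open>density_on UNIV K\<close> \<open>0 < \<theta> i\<close> Kbar(2) f_meas f, of x]
      by (subst E_obs) (simp_all add: k_def)
    finally show ?thesis .
  qed
  \<comment> \<open>The pathwise inequality needs the bound at all times for one realisation;
    countably many null sets are merged into one.\<close>
  have k_le: "AE \<omega> in M. \<forall>i. k i (obs i \<omega>) \<le> Kbar / \<theta> i ^ DIM('a)"
    unfolding AE_all_countable
  proof
    fix i
    have "AE y in lborel. K ((y - x) /\<^sub>R \<theta> i) \<le> Kbar"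
      using Kbar \<open>0 < \<theta> i\<close> by (intro AE_lborel_rescale) auto
    then have "AE y in lborel. k i y \<le> Kbar / \<theta> i ^ DIM('a)"
      by eventually_elim (use \<open>0 < \<theta> i\<close> in \<open>simp add: k_def divide_right_mono\<close>)
    from distributed_AE_lborel[OF D this] show "AE \<omega> in M. k i (obs i \<omega>) \<le> Kbar / \<theta> i ^ DIM('a)" .
  qed

  \<comment> \<open>The predictable weight combines \<open>\<rho> j\<close> with the current error.
    Both the estimate and \<open>g x\<close> lie between 0 and \<open>gbar\<close>, whence the bound
    \<open>\<rho> j * gbar\<close> below.\<close>
  define p where "p j v = \<rho> j * (sqg gl gu K \<rho> \<theta> x z0 v j - g x)" for j v
  define N where "N n \<omega> = (\<Sum>j<n. p j (\<lambda>i. obs i \<omega>) * (k j (obs j \<omega>) - m j))" for n \<omega>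
  have p_meas: "p j \<in> borel_measurable (PiM {..<j} (\<lambda>_. borel))" for j
    unfolding p_def[abs_def]
    by (intro borel_measurable_times borel_measurable_diff sqg_measurable K_meas
        borel_measurable_const measurable_component_singleton) auto
  have p_past: "p j (restrict v {..<j}) = p j v" for j v
    unfolding p_def using sqg_cong[of j "restrict v {..<j}" v] by simp
  have p_bd: "\<bar>p j v\<bar> \<le> \<rho> j * gbar" for j v
  proof -
    have "sqg gl gu K \<rho> \<theta> x z0 v j \<in> {gl x..gu x}"
      using x \<open>z0 \<in> {gl x..gu x}\<close> by (intro sqg_bounds) auto
    then have "\<bar>sqg gl gu K \<rho> \<theta> x z0 v j - g x\<bar> \<le> gbar" using x by auto
    then show ?thesis using \<open>0 \<le> \<rho> j\<close> by (simp add: p_def abs_mult mult_left_mono)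
  qed
  have h_meas: "(\<lambda>y. k j y - m j) \<in> borel_measurable borel" for j by measurable
  have h_bd: "\<bar>k j y - m j\<bar> \<le> Kmax / \<theta> j ^ DIM('a) + \<bar>m j\<bar>" for j y
    using k_bd[of j y] by linarith
  have h_mean: "expectation (\<lambda>\<omega>. k j (obs j \<omega>) - m j) = 0" for j
    using k_int[of j] by (simp add: m_def prob_space)
  note N = predictable_transform[OF indep p_meas p_past p_bd h_meas h_bd h_mean k_var,
      folded N_def]

  define S where "S t = (\<Sum>i\<le>t. \<rho> i)" for t
  have S: "0 < S t" for t
    unfolding S_def using \<open>\<And>t. 0 \<le> \<rho> t\<close> \<open>0 < \<rho> 0\<close> by (intro sum_pos2[of _ 0]) auto
  define R where "R t = (1/2 * (z0 - g x)\<^sup>2 + 2 * gu x * A * H * (\<Sum>i\<le>t. \<rho> i * \<theta> i powr \<nu>)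
      + (gu x)\<^sup>2 * (\<Sum>i\<le>t. (\<rho> i)\<^sup>2)
      + Kbar\<^sup>2 * (\<Sum>i\<le>t. (\<rho> i)\<^sup>2 / \<theta> i ^ (2 * DIM('a)))) / S t" for t
  \<comment> \<open>The index is \<open>Suc t\<close> because \<open>N n\<close> sums over
    \<open>j < n\<close>, while the Cesaro sum includes time \<open>t\<close>.\<close>
  have bound: "AE \<omega> in M. \<bar>zbar t \<omega> - g x\<bar>\<^sup>2 \<le> R t + N (Suc t) \<omega> / S t" for t
    using k_le
  proof eventually_elim
    case (elim \<omega>)
    have "\<bar>cesaro \<rho> (sqg gl gu K \<rho> \<theta> x z0 (\<lambda>j. obs j \<omega>)) t - g x\<bar>\<^sup>2 \<le>
      (1/2 * (z0 - g x)\<^sup>2 + 2 * gu x * (\<Sum>i\<le>t. \<rho> i * (H * A * \<theta> i powr \<nu>))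
        + (gu x)\<^sup>2 * (\<Sum>i\<le>t. (\<rho> i)\<^sup>2)
        + (\<Sum>i\<le>t. (\<rho> i)\<^sup>2 * (Kbar / \<theta> i ^ DIM('a))\<^sup>2)) / (\<Sum>i\<le>t. \<rho> i)
      + (\<Sum>i\<le>t. \<rho> i * ((sqg gl gu K \<rho> \<theta> x z0 (\<lambda>j. obs j \<omega>) i - g x) *
          (1 / \<theta> i ^ DIM('a) * K ((obs i \<omega> - x) /\<^sub>R \<theta> i) - m i))) / (\<Sum>i\<le>t. \<rho> i)"
      using x \<open>z0 \<in> {gl x..gu x}\<close> bias k0 elim \<open>\<And>t. 0 \<le> \<rho> t\<close> \<open>0 < \<rho> 0\<close>
      by (intro sqg_cesaro_energy) (auto simp: k_def)
    moreover have "(\<Sum>i\<le>t. \<rho> i * (H * A * \<theta> i powr \<nu>))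
        = A * H * (\<Sum>i\<le>t. \<rho> i * \<theta> i powr \<nu>)"
      by (simp add: sum_distrib_left mult_ac)
    moreover have "(\<Sum>i\<le>t. (\<rho> i)\<^sup>2 * (Kbar / \<theta> i ^ DIM('a))\<^sup>2)
        = Kbar\<^sup>2 * (\<Sum>i\<le>t. (\<rho> i)\<^sup>2 / \<theta> i ^ (2 * DIM('a)))"
      by (simp add: sum_distrib_left power_divide power_mult[symmetric] mult_ac)
    moreover have "zbar t \<omega> = cesaro \<rho> (sqg gl gu K \<rho> \<theta> x z0 (\<lambda>j. obs j \<omega>)) t"
      by (simp add: \<open>\<And>t \<omega>. zbar t \<omega> = _ t \<omega>\<close> \<open>\<And>t \<omega>. z t \<omega> = _ t \<omega>\<close> cesaro_def)
    ultimately show ?case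
      by (simp add: R_def S_def N_def p_def k_def lessThan_Suc_atMost mult.assoc)
  qed

  have zbar_meas[measurable]: "zbar t \<in> borel_measurable M" for t
  proof -
    have [measurable]: "(\<lambda>\<omega>. sqg gl gu K \<rho> \<theta> x z0 (\<lambda>j. obs j \<omega>) i) \<in> borel_measurable M" for i
      by (rule sqg_measurable[OF K_meas obs])
    have "zbar t = (\<lambda>\<omega>. (\<Sum>j\<le>t. \<rho> j * sqg gl gu K \<rho> \<theta> x z0 (\<lambda>j. obs j \<omega>) j) / S t)"
      by (simp add: fun_eq_iff assms(19,20) cesaro_def S_def)
    then show ?thesis by simp
  qed
  have N_meas[measurable]: "N n \<in> borel_measurable M" for n
    using N(1) by (rule borel_measurable_integrable)
  \<comment> \<open>The kernel bound \<open>K \<le> Kbar\<close> holds only almost everywhere, hence \<open>bound\<close> only almost surely; the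
     maximum changes the noise on a null set so that the inequality holds at every \<open>\<omega>\<close>.\<close>
  define \<zeta> where "\<zeta> t \<omega> = max (N (Suc t) \<omega> / S t) (\<bar>zbar t \<omega> - g x\<bar>\<^sup>2 - R t)" for t \<omega>
  have \<zeta>_meas[measurable]: "\<zeta> t \<in> borel_measurable M" for t
    unfolding \<zeta>_def[abs_def] by measurable
  have \<zeta>_AE: "AE \<omega> in M. \<zeta> t \<omega> = N (Suc t) \<omega> / S t" for t
    using bound[of t] by eventually_elim (simp add: \<zeta>_def max_def)
  have \<zeta>2_AE: "AE \<omega> in M. (\<zeta> t \<omega>)\<^sup>2 = (N (Suc t) \<omega>)\<^sup>2 / (S t)\<^sup>2" for t
    using \<zeta>_AE[of t] by eventually_elim (simp add: power_divide)
  show ?thesis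
  proof (intro exI[of _ \<zeta>] allI conjI ballI)
    fix t
    show "\<bar>zbar t \<omega> - g x\<bar>\<^sup>2 \<le> (1/2 * (z0 - g x)\<^sup>2
          + 2 * gu x * A * H * (\<Sum>i\<le>t. \<rho> i * \<theta> i powr \<nu>)
          + (gu x)\<^sup>2 * (\<Sum>i\<le>t. (\<rho> i)\<^sup>2)
          + Kbar\<^sup>2 * (\<Sum>i\<le>t. (\<rho> i)\<^sup>2 / \<theta> i ^ (2 * DIM('a)))) / (\<Sum>i\<le>t. \<rho> i) + \<zeta> t \<omega>" for \<omega>
      unfolding S_def[symmetric] R_def[symmetric] \<zeta>_def by linarith
    show "integrable M (\<zeta> t)"
      by (subst integrable_cong_AE[OF _ _ \<zeta>_AE]) (use N(1) in auto)
    show "integrable M (\<lambda>\<omega>. (\<zeta> t \<omega>)\<^sup>2)"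
      by (subst integrable_cong_AE[OF _ _ \<zeta>2_AE]) (use N(2) in auto)
    show mean: "expectation (\<zeta> t) = 0"
      by (subst integral_cong_AE[OF _ _ \<zeta>_AE]) (use N(3) in auto)
    \<comment> \<open>The mean is 0, so the variance is the second moment, which agrees with that of
      the scaled martingale.\<close>
    have "variance (\<zeta> t) = expectation (\<lambda>\<omega>. (N (Suc t) \<omega>)\<^sup>2) / (S t)\<^sup>2"
      unfolding mean by (simp, subst integral_cong_AE[OF _ _ \<zeta>2_AE]) auto
    also have "\<dots> \<le> (\<Sum>j<Suc t. (\<rho> j * gbar)\<^sup>2 * (gbar * Kbar / \<theta> j ^ DIM('a))) / (S t)\<^sup>2"
      by (intro divide_right_mono N(4)) auto
    \<comment> \<open>Two factors of \<open>gbar\<close> come from the squared weight bound and the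
      third from the kernel variance.\<close>
    also have "\<dots> = gbar ^ 3 / (S t)\<^sup>2 * (Kbar * (\<Sum>i\<le>t. (\<rho> i)\<^sup>2 / \<theta> i ^ DIM('a)))"
      by (simp add: lessThan_Suc_atMost sum_distrib_left sum_divide_distrib power2_eq_square
          power3_eq_cube mult_ac)
    \<comment> \<open>The first summand of the claimed bound enters here, as a nonnegative
      quantity.\<close>
    also have "\<dots> \<le> gbar ^ 3 / (S t)\<^sup>2 *
        (gbar * (\<Sum>i\<le>t. (\<rho> i)\<^sup>2) + Kbar * (\<Sum>i\<le>t. (\<rho> i)\<^sup>2 / \<theta> i ^ DIM('a)))"
      using x by (intro mult_left_mono) (auto intro!: mult_nonneg_nonneg sum_nonneg)
    finally show "variance (\<zeta> t) \<le> gbar ^ 3 / (\<Sum>i\<le>t. \<rho> i)\<^sup>2 *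
        (gbar * (\<Sum>i\<le>t. (\<rho> i)\<^sup>2) + Kbar * (\<Sum>i\<le>t. (\<rho> i)\<^sup>2 / \<theta> i ^ DIM('a)))"
      unfolding S_def .
  qed
qed

end
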